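(* Let $d\ge2$, let $L\subset\mathbb{R}^d$ be a (full rank) lattice and let $0<D\le4\mu(L)$. Define $V\in(0,2^d\det L]$ by $2r_L(V)=D$. If every facet of $\operatorname{DV}(2L)$ contains a vertex $x$ of $\operatorname{DV}(2L)$ with $\|x\|>r_L(V)$, then $K_L(V)$ is the unique extremal body with respect to $L$ and $V$.
   Context: $\mathbb{R}^d$ carries the standard Euclidean norm $\|\cdot\|$. A (full rank) lattice is a set $L=A\mathbb{Z}^d$ with $A\in\mathrm{GL}_d(\mathbb{R})$, and $\det L=|\det A|$. $\mathcal{K}_L$ is the family of all centrally symmetric convex bodies $K$ (compact convex sets $K\subset\mathbb{R}^d$ with $K=-K$) that contain no non-zero point of $L$ in their interior. $\operatorname{vol}$ is $d$-dimensional Lebesgue measure and $\operatorname{diam}K=2\max_{x\in K}\|x\|$ for such $K$. $B_d(r)=\{x\in\mathbb{R}^d:\|x\|\le r\}$. The Dirichlet-Voronoi cell of a lattice $M$ is the convex polytope $\operatorname{DV}(M)=\{x\in\mathbb{R}^d:\|x\|\le\|x-y\|\text{ for all }y\in M\}$; its facets are its $(d-1)$-dimensional faces; $2L=\{2y:y\in L\}$. The covering radius of $L$ is $\mu(L)=\min\{\mu\in\mathbb{R}: L+B_d(\mu)=\mathbb{R}^d\}$. For $V\in(0,2^d\det L]$, $r_L(V)$ denotes the unique real number $r\in(0,2\mu(L)]$ such that $B_d(r)\cap\operatorname{DV}(2L)$ has volume $V$, and $K_L(V)=B_d(r_L(V))\cap\operatorname{DV}(2L)$. A body $K\in\mathcal{K}_L$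 is an extremal body with respect to $L$ and $V$ if $\operatorname{vol}K=V$ and $\operatorname{diam}K=\min\{\operatorname{diam}K':K'\in\mathcal{K}_L,\ \operatorname{vol}K'=V\}$; this minimum equals $\operatorname{diam}K_L(V)$. *)

theory Defs
  imports "HOL-Analysis.Analysis"
begin

definition lattice_of_matrix :: "real^'n^'n \<Rightarrow> (real^'n) set"
  where "lattice_of_matrix A = {A *v z | z. \<forall>i. z $ i \<in> \<int>}"

definition is_lattice :: "(real^'n) set \<Rightarrow> bool"
  where "is_lattice L \<longleftrightarrow> (\<exists>A. invertible A \<and> L = lattice_of_matrix A)"

text \<open>All generating matrices of a lattice have the same absolute determinant, so the
  description below is proper for lattices.\<close>

definition lattice_det :: "(real^'n) set \<Rightarrow> real"
  where "lattice_det L =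
    (THE \<delta>. \<exists>A. invertible A \<and> L = lattice_of_matrix A \<and> \<delta> = \<bar>det A\<bar>)"

definition DV :: "(real^'n) set \<Rightarrow> (real^'n) set"
  where "DV M = {x. \<forall>y\<in>M. norm x \<le> norm (x - y)}"

definition double :: "(real^'n) set \<Rightarrow> (real^'n) set"
  where "double L = (\<lambda>y. 2 *\<^sub>R y) ` L"

definition covering_radius :: "(real^'n) set \<Rightarrow> real"
  where "covering_radius L =
    (LEAST \<mu>. {x + b | x b. x \<in> L \<and> b \<in> cball 0 \<mu>} = UNIV)"

text \<open>Bodies are not required to have interior points (nor to be nonempty); this is immaterial
  below, where only bodies of prescribed positive volume are compared.\<close>

definition admissible_bodies :: "(real^'n) set \<Rightarrow> (real^'n) set set"
  where "admissible_bodies L =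
    {K. compact K \<and> convex K \<and> K = uminus ` K \<and> (\<forall>x\<in>L. x \<noteq> 0 \<longrightarrow> x \<notin> interior K)}"

text \<open>The radius \<open>r_L(V)\<close> and the body \<open>K_L(V)\<close>, meaningful for a lattice \<open>L\<close> and
  \<open>0 < V \<le> 2^d det L\<close>.\<close>

definition r_of :: "(real^'n) set \<Rightarrow> real \<Rightarrow> real"
  where "r_of L V =
    (THE r. 0 < r \<and> r \<le> 2 * covering_radius L \<and>
            measure lborel (cball 0 r \<inter> DV (double L)) = V)"

definition K_of :: "(real^'n) set \<Rightarrow> real \<Rightarrow> (real^'n) set"
  where "K_of L V = cball 0 (r_of L V) \<inter> DV (double L)"

definition extremal_body :: "(real^'n) set \<Rightarrow> real \<Rightarrow> (real^'n) set \<Rightarrow> bool"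
  where "extremal_body L V K \<longleftrightarrow>
    K \<in> admissible_bodies L \<and> measure lborel K = V \<and>
    (\<forall>K'\<in>admissible_bodies L. measure lborel K' = V \<longrightarrow> diameter K \<le> diameter K')"

end

theory Submission
  imports Defs
begin

text \<open>
  Let \<open>M = 2L\<close>. A symmetric convex body \<open>K\<close> is admissible iff the \<open>M\<close>-translates of its interior are
  disjoint, so reducing \<open>K \<subseteq> B(R)\<close> modulo \<open>M\<close> into \<open>DV M\<close>, which never increases norms, shows
  \<open>vol K \<le> vol (B(R) \<inter> DV M)\<close>; hence \<open>K_L(V)\<close> is extremal. For another extremal body \<open>K\<close> equality
  holds with \<open>R = r\<close>, so the translates of \<open>K\<close> cover \<open>B(r)\<close>. Let \<open>F\<close> be a facet with bisector vector
  \<open>v\<close> and \<open>norm v / 2 < r\<close>. Since \<open>F\<close> contains a point outside \<open>B(r)\<close> and its centre \<open>v/2\<close> lies in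
  its relative interior, there is a point \<open>p\<close> in the relative interior of \<open>F\<close> with \<open>norm p = r\<close>. Only
  \<open>K\<close> can cover points near \<open>p\<close> on the outer side of the ball around \<open>v\<close>, so \<open>p\<close> and likewise
  \<open>v - p\<close> belong to \<open>K\<close>. A hyperplane supporting \<open>K\<close> at \<open>v/2\<close> with normal \<open>a\<close> therefore satisfies
  \<open>a \<bullet> (p - v/2) = 0\<close>; letting \<open>p\<close> vary over an open part of the sphere in the facet hyperplane
  makes \<open>a\<close> parallel to \<open>v\<close>. So \<open>K\<close> satisfies every facet inequality of \<open>DV M\<close>, whence
  \<open>K = B(r) \<inter> DV M\<close>.
\<close>

section \<open>Volume under linear maps and the determinant of a lattice\<close>

text \<open>Both conclusions pass to compositions, so it suffices to check elementary maps: those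
  killing a coordinate, stretches, shears and transpositions.\<close>

lemma linear_image_lebesgue:
  fixes f :: "real^'n \<Rightarrow> real^'n"
  assumes "linear f" "S \<in> lmeasurable"
  shows "f ` S \<in> lmeasurable"
    and "measure lebesgue (f ` S) = \<bar>det (matrix f)\<bar> * measure lebesgue S"
proof -
  define P where "P = (\<lambda>f::real^'n \<Rightarrow> real^'n. linear f \<and> (\<forall>S\<in>lmeasurable. f ` S \<in> lmeasurable \<and>
    measure lebesgue (f ` S) = \<bar>det (matrix f)\<bar> * measure lebesgue S))"
  have comp: "P (f \<circ> g)" if f: "P f" and g: "P g" for f g
    unfolding P_def
  proof (intro conjI ballI)
    show "linear (f \<circ> g)"
      using f g by (simp add: P_def linear_compose)
    fix S :: "(real^'n) set" assume S: "S \<in> lmeasurable"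
    then have gS: "g ` S \<in> lmeasurable"
      using g by (simp add: P_def)
    show "(f \<circ> g) ` S \<in> lmeasurable"
      using f gS by (simp only: P_def image_comp [symmetric])
    have "measure lebesgue ((f \<circ> g) ` S) = \<bar>det (matrix f)\<bar> * measure lebesgue (g ` S)"
      using f gS by (simp only: P_def image_comp [symmetric])
    also have "\<dots> = \<bar>det (matrix (f \<circ> g))\<bar> * measure lebesgue S"
      using f g S by (simp add: P_def matrix_compose det_mul abs_mult)
    finally show "measure lebesgue ((f \<circ> g) ` S) = \<bar>det (matrix (f \<circ> g))\<bar> * measure lebesgue S" .
  qed
  have stretch: "P (\<lambda>x. \<chi> i. c i * x $ i)" for c
  proof -
    have "linear (\<lambda>x::real^'n. \<chi> i. c i * x $ i)"
      by (rule linearI) (simp_all add: vec_eq_iff algebra_simps)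
    moreover have "det (matrix (\<lambda>x::real^'n. \<chi> i. c i * x $ i)) = prod c UNIV"
      by (simp add: matrix_def det_diagonal axis_def)
    ultimately show ?thesis
      by (simp add: P_def measurable_stretch measure_stretch)
  qed
  have shear: "P (\<lambda>x. \<chi> i. if i = m then x $ m + x $ n else x $ i)" (is "P ?h")
    if mn: "m \<noteq> n" for m n
  proof -
    have lin: "linear ?h"
      by (rule linearI) (auto simp: vec_eq_iff algebra_simps)
    have "matrix ?h = (\<chi> k. if k = m then row m (mat 1) + 1 *s row n (mat 1) else row k (mat 1))"
      using mn by (auto simp: matrix_def row_def mat_def axis_def vec_eq_iff)
    then have det: "det (matrix ?h) = 1"
      using det_row_operation [OF mn, of "mat 1 :: real^'n^'n" 1] by simp
    have box: "measure lebesgue (?h ` cbox a b) = measure lebesgue (cbox a b)" for a b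
    proof (cases "cbox a b = {}")
      case False
      \<comment> \<open>The interval formula for shears asks for a nonnegative lower bound in
        coordinate \<open>n\<close>. Translating by \<open>w\<close> moves that bound to 0, and by
        linearity the sheared box is merely translated too.\<close>
      define w :: "real^'n" where "w = - (a $ n) *\<^sub>R axis n 1"
      have tr: "cbox (w + a) (w + b) = (+) w ` cbox a b"
        by (simp add: cbox_translation)
      have "measure lebesgue (?h ` cbox a b) = measure lebesgue ((+) (?h w) ` ?h ` cbox a b)"
        by (simp add: measure_translation)
      also have "(+) (?h w) ` ?h ` cbox a b = ?h ` (+) w ` cbox a b"
        by (simp add: image_comp o_def linear_add [OF lin])
      also have "measure lebesgue \<dots> = measure lebesgue (cbox (w + a) (w + b))"
        unfolding tr [symmetric]
        by (rule measure_shear_interval) (use mn False tr in \<open>auto simp: w_def\<close>)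
      also have "\<dots> = measure lebesgue (cbox a b)"
        unfolding tr by (rule measure_translation)
      finally show ?thesis .
    qed auto
    have "?h ` S \<in> lmeasurable \<and> measure lebesgue (?h ` S) = measure lebesgue S"
      if "S \<in> lmeasurable" for S
      using measure_linear_sufficient [OF lin that, of 1] by (simp only: box mult_1)
    then show ?thesis
      unfolding P_def det using lin by simp
  qed
  have "P f"
  proof (rule induct_linear_elementary [OF assms(1)])
    fix f :: "real^'n \<Rightarrow> real^'n" and i
    assume lin: "linear f" and 0: "\<And>x. f x $ i = 0"
    then have "\<not> inj f"
      by (metis linear_injective_imp_surjective one_neq_zero surjE vec_component)
    then have "det (matrix f) = 0" "\<And>S. negligible (f ` S)"
      using det_nz_iff_inj [OF lin] negligible_linear_singular_image [OF lin] by auto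
    then show "P f"
      using lin by (simp add: P_def negligible_imp_measurable negligible_imp_measure0)
  next
    \<comment> \<open>A transposition is a product of shears and reflections.\<close>
    fix m n :: 'n
    assume mn: "m \<noteq> n"
    let ?s = "\<lambda>m n (x::real^'n). \<chi> i. if i = m then x $ m + x $ n else x $ i"
    let ?d = "\<lambda>x::real^'n. \<chi> i. (if i = n then -1 else 1) * x $ i"
    have *: "(\<lambda>x::real^'n. \<chi> i. x $ Transposition.transpose m n i) =
        ?d \<circ> ?s m n \<circ> ?d \<circ> ?s n m \<circ> ?d \<circ> ?s m n"
      using mn by (intro ext) (simp add: vec_eq_iff Transposition.transpose_def)
    show "P (\<lambda>x. \<chi> i. x $ Transposition.transpose m n i)"
      unfolding * by (intro comp stretch shear mn not_sym)
  qed (rule comp stretch shear; assumption)+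
  then show "f ` S \<in> lmeasurable" "measure lebesgue (f ` S) = \<bar>det (matrix f)\<bar> * measure lebesgue S"
    using assms(2) by (simp_all add: P_def)
qed

lemma det_Ints:
  fixes X :: "real^'n^'n"
  assumes "\<And>i j. X $ i $ j \<in> \<int>"
  shows "det X \<in> \<int>"
  unfolding det_def by (intro Ints_sum Ints_mult Ints_prod) (use assms in auto)

lemma lattice_matrix_factor:
  fixes A B :: "real^'n^'n"
  assumes "lattice_of_matrix A \<subseteq> lattice_of_matrix B"
  obtains X where "A = B ** X" "\<And>i j. X $ i $ j \<in> \<int>"
proof -
  have "\<exists>z. (\<forall>i. z $ i \<in> \<int>) \<and> A *v axis j 1 = B *v z" for j
  proof -
    have "A *v axis j 1 \<in> lattice_of_matrix A"
      unfolding lattice_of_matrix_def by (auto simp: axis_def)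
    then show ?thesis
      using assms unfolding lattice_of_matrix_def by blast
  qed
  then obtain z where z: "\<And>j i. z j $ i \<in> \<int>" "\<And>j. A *v axis j 1 = B *v z j"
    by metis
  define X where "X = (\<chi> i j. z j $ i)"
  have "A *v axis j 1 = (B ** X) *v axis j 1" for j
    using z(2)[of j] unfolding matrix_vector_mul_assoc [symmetric]
    by (simp add: X_def matrix_vector_mult_basis column_def)
  then have "A = B ** X"
    by (simp add: matrix_vector_mult_basis column_def vec_eq_iff)
  then show thesis
    using that z(1) by (simp add: X_def)
qed

text \<open>Two generating matrices differ by an integer factor, whose nonzero determinant has
  absolute value at least 1. Used in both directions, this makes the description in
  \<open>lattice_det\<close> proper.\<close>

lemma lattice_det_eq:
  fixes A :: "real^'n^'n"
  assumes A: "invertible A"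
  shows "lattice_det (lattice_of_matrix A) = \<bar>det A\<bar>"
  unfolding lattice_det_def
proof (rule the_equality)
  show "\<exists>B. invertible B \<and> lattice_of_matrix A = lattice_of_matrix B \<and> \<bar>det A\<bar> = \<bar>det B\<bar>"
    using A by blast
next
  fix \<delta>
  assume "\<exists>B. invertible B \<and> lattice_of_matrix A = lattice_of_matrix B \<and> \<delta> = \<bar>det B\<bar>"
  then obtain B where B: "invertible B" "lattice_of_matrix A = lattice_of_matrix B" "\<delta> = \<bar>det B\<bar>"
    by blast
  have le: "\<bar>det D\<bar> \<le> \<bar>det C\<bar>"
    if C: "invertible C" "lattice_of_matrix C = lattice_of_matrix D" for C D :: "real^'n^'n"
  proof -
    obtain X where X: "C = D ** X" "\<And>i j. X $ i $ j \<in> \<int>"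
      using lattice_matrix_factor C(2) by blast
    have "det C \<noteq> 0"
      using C(1) by (simp add: invertible_det_nz)
    then have "1 \<le> \<bar>det X\<bar>"
      using X det_Ints [of X] by (auto intro!: Ints_nonzero_abs_ge1 simp: det_mul)
    then show ?thesis
      using X(1) by (simp add: det_mul abs_mult mult_le_cancel_left1)
  qed
  show "\<delta> = \<bar>det A\<bar>"
    using le [OF A B(2)] le [OF B(1) B(2) [symmetric]] B(3) by linarith
qed

section \<open>Bisectors, and positive measure from convexity\<close>

lemma norm_le_diff_iff:
  fixes x y :: "'a::real_inner"
  shows "norm x \<le> norm (x - y) \<longleftrightarrow> y \<bullet> x \<le> y \<bullet> y / 2"
    and "norm x < norm (x - y) \<longleftrightarrow> y \<bullet> x < y \<bullet> y / 2"
    and "norm x = norm (x - y) \<longleftrightarrow> y \<bullet> x = y \<bullet> y / 2"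
  by (auto simp: norm_le norm_lt norm_eq inner_diff_left inner_diff_right inner_commute)

text \<open>A convex set with nonempty interior lies in the closure of that interior, so an open set
  meeting it also meets the interior. This later turns equality of volumes into inclusion.\<close>

lemma measure_pos_convex:
  fixes C :: "'a::euclidean_space set"
  assumes "convex C" "interior C \<noteq> {}" "open U" "U \<inter> C \<noteq> {}" "U \<inter> C \<subseteq> T" "T \<in> lmeasurable"
  shows "0 < measure lebesgue T"
proof (rule ccontr)
  assume "\<not> 0 < measure lebesgue T"
  then have "negligible T"
    using assms(6) by (metis measure_nonneg negligible_iff_measure order_less_le)
  moreover have "U \<inter> interior C \<subseteq> T"
    using assms(5) interior_subset by blast
  ultimately have "negligible (U \<inter> interior C)"
    by (rule negligible_subset)
  moreover have "open (U \<inter> interior C)"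
    using assms(3) by blast
  ultimately have "U \<inter> interior C = {}"
    using open_not_negligible by blast
  then have "U \<inter> closure (interior C) = {}"
    using open_Int_closure_eq_empty [OF assms(3)] by blast
  then show False
    using assms(4) closure_subset [of C] convex_closure_interior [OF assms(1,2)] by blast
qed

section \<open>Dirichlet-Voronoi cells of discrete cocompact groups\<close>

text \<open>\<open>M\<close> stands for \<open>2L\<close>. The geometry of the cell rests on these
  group properties; generating matrices enter with the instantiation.\<close>

locale discrete_cocompact =
  fixes M :: "(real^'n) set"
  assumes zero: "0 \<in> M"
    and diff: "u \<in> M \<Longrightarrow> v \<in> M \<Longrightarrow> u - v \<in> M"
    and finite_cball: "finite (M \<inter> cball 0 R)"
    and cocompact: "\<exists>R. \<forall>x. \<exists>u\<in>M. norm (x - u) \<le> R"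
begin

lemma uminus: "u \<in> M \<Longrightarrow> - u \<in> M"
  using diff zero by fastforce

lemma add: "u \<in> M \<Longrightarrow> v \<in> M \<Longrightarrow> u + v \<in> M"
  using diff uminus by fastforce

lemma mem_DV: "x \<in> DV M \<longleftrightarrow> (\<forall>u\<in>M. u \<bullet> x \<le> u \<bullet> u / 2)"
  by (simp add: DV_def norm_le_diff_iff)

text \<open>Subtract a point of \<open>M\<close> nearest to \<open>x\<close>. It can be sought in
  the finite set \<open>?T\<close>, since points of \<open>M\<close> outside it are at least as far
  from \<open>x\<close> as 0 is.\<close>

lemma reduce: "\<exists>u\<in>M. x - u \<in> DV M"
proof -
  let ?T = "M \<inter> cball 0 (2 * norm x)"
  have T: "finite ?T" "0 \<in> ?T"
    using finite_cball zero by auto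
  define u where "u = arg_min_on (\<lambda>w. norm (x - w)) ?T"
  have u: "u \<in> ?T" "\<And>w. w \<in> ?T \<Longrightarrow> norm (x - u) \<le> norm (x - w)"
    unfolding u_def by (rule arg_min_if_finite(1) arg_min_least; use T in blast)+
  have *: "norm (x - u) \<le> norm (x - w)" if "w \<in> M" for w
  proof (cases "w \<in> ?T")
    case False
    then have "2 * norm x < norm w"
      using that by auto
    then show ?thesis
      using u(2) [OF T(2)] norm_triangle_ineq3 [of w x] by (simp add: norm_minus_commute)
  qed (rule u)
  have "norm (x - u) \<le> norm (x - u - w)" if "w \<in> M" for w
    using * [of "u + w"] add that u(1) by (simp add: diff_diff_eq)
  then show ?thesis
    using u(1) unfolding DV_def by blast
qed

lemma DV_subset_cball:
  assumes "\<And>x. \<exists>u\<in>M. norm (x - u) \<le> R"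
  shows "DV M \<subseteq> cball 0 R"
proof
  fix x assume "x \<in> DV M"
  moreover obtain u where "u \<in> M" "norm (x - u) \<le> R"
    using assms by blast
  ultimately show "x \<in> cball 0 R"
    by (force simp: DV_def)
qed

lemma bounded_DV: "bounded (DV M)"
proof -
  obtain R where "\<And>x. \<exists>u\<in>M. norm (x - u) \<le> R"
    using cocompact by blast
  then show ?thesis
    using bounded_subset [OF bounded_cball DV_subset_cball] by metis
qed

text \<open>If every point is within \<open>R\<close> of \<open>M\<close>, the polyhedron
  \<open>Q\<close> cut out by the vectors of norm at most \<open>2 * R + 1\<close> lies in the ball
  of radius \<open>R\<close>; longer vectors then impose no further condition.\<close>

lemma DV_finite_halfspaces:
  obtains S where "finite S" "S \<subseteq> M" "DV M = (\<Inter>u\<in>S. {x. u \<bullet> x \<le> u \<bullet> u / 2})"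
proof -
  obtain R where R: "\<And>x. \<exists>u\<in>M. norm (x - u) \<le> R"
    using cocompact by blast
  define S where "S = M \<inter> cball 0 (2 * R + 1)"
  define Q where "Q = (\<Inter>u\<in>S. {x. u \<bullet> x \<le> u \<bullet> u / 2})"
  have mem: "x \<in> Q \<longleftrightarrow> (\<forall>u\<in>S. norm x \<le> norm (x - u))" for x
    by (simp add: Q_def norm_le_diff_iff)
  have "0 \<le> R"
    using R [of 0] norm_ge_zero order_trans by blast
  have conv: "convex Q"
    unfolding Q_def by (intro convex_INT convex_halfspace_le)
  have le: "norm x \<le> R" if "x \<in> Q" for x
  proof (rule ccontr)
    assume x: "\<not> norm x \<le> R"
    \<comment> \<open>Pulling \<open>x\<close> towards 0 to a norm in \<open>(R, R + 1]\<close>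
      keeps it in \<open>Q\<close> and puts every point of \<open>M\<close> within \<open>R\<close>
      of it into \<open>S\<close>.\<close>
    define s where "s = min 1 ((R + 1) / norm x)"
    have pos: "0 < norm x"
      using x \<open>0 \<le> R\<close> by linarith
    then have s: "0 \<le> s" "s \<le> 1" "s * norm x \<le> R + 1" "R < s * norm x"
      using x \<open>0 \<le> R\<close> by (auto simp: s_def min_def field_simps)
    have "0 \<in> Q"
      by (simp add: mem)
    then have "s *\<^sub>R x \<in> Q"
      using convexD [OF conv, of 0 x "1 - s" s] s that by simp
    moreover obtain u where u: "u \<in> M" "norm (s *\<^sub>R x - u) \<le> R"
      using R by blast
    moreover have "norm u \<le> 2 * R + 1"
      using norm_triangle_ineq4 [of "s *\<^sub>R x" "s *\<^sub>R x - u"] u(2) s by simp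
    ultimately have "s * norm x \<le> R"
      using s by (force simp: mem S_def)
    then show False
      using s by simp
  qed
  have "Q \<subseteq> DV M"
  proof
    fix x assume x: "x \<in> Q"
    have "norm x \<le> norm (x - u)" if "u \<in> M" for u
    proof (cases "u \<in> S")
      case False
      then have "2 * R + 1 < norm u"
        using that by (simp add: S_def)
      then show ?thesis
        using le [OF x] norm_triangle_ineq3 [of u x] by (simp add: norm_minus_commute)
    qed (use x mem in blast)
    then show "x \<in> DV M"
      by (simp add: DV_def)
  qed
  moreover have "DV M \<subseteq> Q"
    by (auto simp: mem_DV Q_def S_def)
  ultimately show thesis
    using that [of S] finite_cball by (auto simp: S_def Q_def)
qed

lemma polyhedron_DV: "polyhedron (DV M)"
proof -
  obtain S where "finite S" "DV M = (\<Inter>u\<in>S. {x. u \<bullet> x \<le> u \<bullet> u / 2})"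
    by (rule DV_finite_halfspaces)
  then show ?thesis
    by (simp only:) (intro polyhedron_Inter finite_imageI; blast intro: polyhedron_halfspace_le)
qed

lemma convex_DV: "convex (DV M)"
  by (simp add: polyhedron_DV polyhedron_imp_convex)

lemma compact_DV: "compact (DV M)"
  by (simp add: bounded_DV compact_eq_bounded_closed polyhedron_DV polyhedron_imp_closed)

lemma zero_in_DV: "0 \<in> DV M"
  by (simp add: DV_def)

lemma interior_DV:
  assumes "\<And>u. u \<in> M \<Longrightarrow> u \<noteq> 0 \<Longrightarrow> u \<bullet> z < u \<bullet> u / 2"
  shows "z \<in> interior (DV M)"
proof -
  obtain S where S: "finite S" "S \<subseteq> M" "DV M = (\<Inter>u\<in>S. {x. u \<bullet> x \<le> u \<bullet> u / 2})"
    by (rule DV_finite_halfspaces)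
  let ?U = "\<Inter>u\<in>S - {0}. {x. u \<bullet> x < u \<bullet> u / 2}"
  have "open ?U"
    using S(1) by (intro open_INT ballI open_halfspace_lt) simp
  moreover have "z \<in> ?U"
    using assms S by auto
  moreover have "?U \<subseteq> DV M"
    unfolding S(3) by force
  ultimately show ?thesis
    by (meson interiorI)
qed

lemma zero_in_interior_DV: "0 \<in> interior (DV M)"
  by (rule interior_DV) simp

lemma uminus_DV:
  assumes "x \<in> DV M"
  shows "- x \<in> DV M"
  unfolding mem_DV
proof
  fix u assume "u \<in> M"
  then have "(- u) \<bullet> x \<le> (- u) \<bullet> (- u) / 2"
    using assms uminus mem_DV by blast
  then show "u \<bullet> - x \<le> u \<bullet> u / 2"
    by simp
qed

text \<open>A relative interior point \<open>z\<close> of \<open>F\<close> lies on some bisector,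
  which then contains all of \<open>F\<close>; a dimension count leaves just one. The last
  conclusion says that the centre \<open>v/2\<close> is strictly inside every other
  half-space.\<close>

lemma facet_bisector:
  assumes F: "F facet_of DV M"
  obtains v where "v \<in> M" "v \<noteq> 0" "F \<subseteq> {x. v \<bullet> x = v \<bullet> v / 2}"
    "\<And>u. u \<in> M \<Longrightarrow> u \<noteq> 0 \<Longrightarrow> u \<noteq> v \<Longrightarrow> u \<bullet> v < u \<bullet> u"
proof -
  have face: "F face_of DV M" and dim: "aff_dim F = DIM(real^'n) - 1" and "F \<noteq> {}" and "F \<noteq> DV M"
    using F zero_in_interior_DV aff_dim_nonempty_interior [of "DV M"] facet_of_irrefl
    by (auto simp: facet_of_def)
  have FP: "F \<subseteq> DV M" and convF: "convex F"
    using face face_of_imp_subset face_of_imp_convex by auto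
  obtain z where z: "z \<in> rel_interior F"
    using convF \<open>F \<noteq> {}\<close> rel_interior_eq_empty by blast
  have zF: "z \<in> F"
    using z rel_interior_subset by blast
  have le: "u \<bullet> z \<le> u \<bullet> u / 2" if "u \<in> M" for u
    using zF FP mem_DV that by blast
  have sub: "F \<subseteq> {x. u \<bullet> x = u \<bullet> u / 2}" if "u \<in> M" "u \<bullet> z = u \<bullet> u / 2" for u
  proof -
    have "(DV M \<inter> {x. u \<bullet> x = u \<bullet> u / 2}) face_of DV M"
      by (rule face_of_Int_supporting_hyperplane_le [OF convex_DV]) (use that mem_DV in blast)
    from subset_of_face_of [OF this FP] show ?thesis
      using z zF FP that by blast
  qed
  have hull: "affine hull F = {x. u \<bullet> x = u \<bullet> u / 2}" if "u \<in> M" "u \<noteq> 0" "u \<bullet> z = u \<bullet> u / 2" for u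
  proof (rule affine_dim_equal)
    show "affine hull F \<subseteq> {x. u \<bullet> x = u \<bullet> u / 2}"
      by (rule hull_minimal [where S = affine, OF sub affine_hyperplane]) (fact that)+
    show "aff_dim (affine hull F) = aff_dim {x. u \<bullet> x = u \<bullet> u / 2}"
      using dim that(2) by (simp only: aff_dim_affine_hull aff_dim_hyperplane not_False_eq_True)
  qed (simp_all only: \<open>F \<noteq> {}\<close> affine_hyperplane affine_affine_hull affine_hull_eq_empty not_False_eq_True)
  have "z \<notin> interior (DV M)"
    using face_of_disjoint_interior [OF face \<open>F \<noteq> DV M\<close>] zF by blast
  then obtain v where v: "v \<in> M" "v \<noteq> 0" "\<not> v \<bullet> z < v \<bullet> v / 2"
    using interior_DV by blast
  then have vz: "v \<bullet> z = v \<bullet> v / 2"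
    using le [OF v(1)] by linarith
  have strict: "u \<bullet> z < u \<bullet> u / 2" if "u \<in> M" "u \<noteq> 0" "u \<noteq> v" for u
  proof (rule ccontr)
    assume "\<not> u \<bullet> z < u \<bullet> u / 2"
    then have "u \<bullet> z = u \<bullet> u / 2"
      using le [OF that(1)] by linarith
    then have eq: "{x. u \<bullet> x = u \<bullet> u / 2} = {x. v \<bullet> x = v \<bullet> v / 2}"
      using hull [of u] hull [of v] that v vz by simp
    \<comment> \<open>A bisector contains the midpoint of its own vector. With the two hyperplanes
      equal, each midpoint lies on both, which forces \<open>u = v\<close>.\<close>
    have "(1/2) *\<^sub>R u \<in> {x. v \<bullet> x = v \<bullet> v / 2}" "(1/2) *\<^sub>R v \<in> {x. u \<bullet> x = u \<bullet> u / 2}"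
      by (simp only: eq [symmetric], simp) (simp only: eq, simp)
    then have "v \<bullet> u = v \<bullet> v" "u \<bullet> v = u \<bullet> u"
      by simp_all
    then have "(u - v) \<bullet> (u - v) = 0"
      by (simp add: inner_diff_left inner_diff_right)
    then show False
      using that by simp
  qed
  \<comment> \<open>The reflection in \<open>v/2\<close> preserves strictness, which is an affine condition,
    so it passes from \<open>z\<close> and \<open>v - z\<close> to their midpoint \<open>v/2\<close>.\<close>
  have "u \<bullet> v < u \<bullet> u" if u: "u \<in> M" "u \<noteq> 0" "u \<noteq> v" for u
  proof -
    have "(v - u) \<bullet> z < (v - u) \<bullet> (v - u) / 2"
      by (rule strict) (use diff v u in auto)
    moreover have "(v - u) \<bullet> z = v \<bullet> z - u \<bullet> z" "(v - u) \<bullet> (v - u) = v \<bullet> v - 2 * (u \<bullet> v) + u \<bullet> u"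
      by (simp_all add: inner_diff_left inner_diff_right inner_commute)
    ultimately show ?thesis
      using strict [OF u] vz by linarith
  qed
  then show thesis
    by (rule that [OF v(1,2) sub [OF v(1) vz]])
qed

text \<open>Any step from \<open>v/2\<close> in direction \<open>v\<close> violates the inequality
  of \<open>v\<close> itself.\<close>

lemma half_not_interior_DV:
  assumes "v \<in> M" "v \<noteq> 0"
  shows "(1/2) *\<^sub>R v \<notin> interior (DV M)"
proof
  assume "(1/2) *\<^sub>R v \<in> interior (DV M)"
  then obtain e where e: "0 < e" "cball ((1/2) *\<^sub>R v) e \<subseteq> DV M"
    by (meson mem_interior_cball)
  have "(1/2) *\<^sub>R v + (e / norm v) *\<^sub>R v \<in> cball ((1/2) *\<^sub>R v) e"
    using e assms by (simp add: dist_norm)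
  then have "v \<bullet> ((1/2) *\<^sub>R v + (e / norm v) *\<^sub>R v) \<le> v \<bullet> v / 2"
    using e(2) assms mem_DV by blast
  then have "1/2 * (v \<bullet> v) + (e / norm v) * (v \<bullet> v) \<le> v \<bullet> v / 2"
    by (simp only: inner_add_right inner_scaleR_right)
  then have "(e / norm v) * (v \<bullet> v) \<le> 0"
    by linarith
  moreover have "0 < (e / norm v) * (v \<bullet> v)"
    using e assms by simp
  ultimately show False
    by simp
qed

section \<open>Volumes inside the cell and the packing bound\<close>

lemma DV_cball_lmeasurable: "cball 0 r \<inter> DV M \<in> lmeasurable"
  by (simp add: compact_DV compact_Int lmeasurable_compact)

text \<open>Cut \<open>Q\<close> along the translates of the cell and move the pieces into the cell.
  They stay disjoint because the translates of \<open>Q\<close> are, and stay in the ball because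
  reduction never increases norms. The union is kept in the bound for the equality case.\<close>

lemma measure_le_DV:
  assumes Q: "Q \<in> lmeasurable" "Q \<subseteq> cball 0 R"
    and disj: "\<And>u. u \<in> M \<Longrightarrow> u \<noteq> 0 \<Longrightarrow> Q \<inter> (+) u ` Q = {}"
  obtains N where "finite N" "N \<subseteq> M"
    "measure lebesgue Q \<le> measure lebesgue (cball 0 R \<inter> DV M \<inter> (\<Union>u\<in>N. (+) u ` Q))"
proof -
  \<comment> \<open>A point of \<open>Q\<close> and its reduction both have norm at most
    \<open>R\<close>, so they differ by a vector of norm at most \<open>2 * R\<close>.\<close>
  define N where "N = M \<inter> cball 0 (2 * R)"
  define T where "T u = DV M \<inter> (+) u ` Q" for u
  have N: "finite N" "N \<subseteq> M"
    by (auto simp: N_def finite_cball)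
  have T: "T u \<in> lmeasurable" for u
    by (simp add: T_def Q compact_DV fmeasurable.Int lmeasurable_compact measurable_translation)
  have "Q \<subseteq> (\<Union>u\<in>N. (+) (- u) ` T u)"
  proof
    fix x assume x: "x \<in> Q"
    obtain u where u: "u \<in> M" "x - u \<in> DV M"
      using reduce by blast
    have "norm (x - u) \<le> norm (x - u - (- u))"
      using u uminus unfolding DV_def by blast
    then have "norm u \<le> 2 * R"
      using x Q(2) norm_triangle_ineq4 [of x "x - u"] by force
    then have "- u \<in> N"
      using u uminus by (simp add: N_def)
    moreover have "x - u \<in> T (- u)"
      using u x by (auto simp: T_def)
    ultimately show "x \<in> (\<Union>u\<in>N. (+) (- u) ` T u)"
      by (intro UN_I image_eqI [of _ _ "x - u"]) auto
  qed
  then have "measure lebesgue Q \<le> measure lebesgue (\<Union>u\<in>N. (+) (- u) ` T u)"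
    by (intro measure_mono_fmeasurable fmeasurable.finite_UN N measurable_translation T)
      (use Q in auto)
  also have "\<dots> \<le> (\<Sum>u\<in>N. measure lebesgue ((+) (- u) ` T u))"
    by (intro measure_UNION_le N fmeasurableD measurable_translation T)
  also have "\<dots> = (\<Sum>u\<in>N. measure lebesgue (T u))"
    by (simp only: measure_translation)
  also have "\<dots> = measure lebesgue (\<Union>u\<in>N. T u)"
  proof (rule measure_finite_Union [symmetric])
    show "disjoint_family_on T N"
      unfolding disjoint_family_on_def
    proof (intro ballI impI equals0I)
      fix u w y assume uw: "u \<in> N" "w \<in> N" "u \<noteq> w" and "y \<in> T u \<inter> T w"
      then obtain q q' where q: "q \<in> Q" "q' \<in> Q" "y = u + q" "y = w + q'"
        by (auto simp: T_def)
      then have "q = (w - u) + q'"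
        by (simp add: algebra_simps)
      moreover have "w - u \<in> M"
        using uw N diff by blast
      ultimately show False
        using disj [of "w - u"] q(1,2) uw(3) by auto
    qed
  qed (use N T fmeasurableD2 [OF T] in \<open>auto simp del: emeasure_completion\<close>)
  also have "\<dots> \<le> measure lebesgue (cball 0 R \<inter> DV M \<inter> (\<Union>u\<in>N. (+) u ` Q))"
  proof (rule measure_mono_fmeasurable)
    show "(\<Union>u\<in>N. T u) \<subseteq> cball 0 R \<inter> DV M \<inter> (\<Union>u\<in>N. (+) u ` Q)"
    proof
      fix y assume "y \<in> (\<Union>u\<in>N. T u)"
      then obtain u q where y: "u \<in> N" "y \<in> DV M" "q \<in> Q" "y = u + q"
        by (auto simp: T_def)
      then have "norm y \<le> norm (y - u)"
        using N(2) unfolding DV_def by blast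
      also have "\<dots> \<le> R"
        using y Q(2) by auto
      finally show "y \<in> cball 0 R \<inter> DV M \<inter> (\<Union>u\<in>N. (+) u ` Q)"
        using y by auto
    qed
    show "(\<Union>u\<in>N. T u) \<in> sets lebesgue"
      using N T by (intro fmeasurableD fmeasurable.finite_UN)
    show "cball 0 R \<inter> DV M \<inter> (\<Union>u\<in>N. (+) u ` Q) \<in> lmeasurable"
      by (intro fmeasurable.Int DV_cball_lmeasurable fmeasurable.finite_UN N measurable_translation Q)
  qed
  finally show thesis
    using that N by blast
qed

lemma zero_in_interior_cball_DV: "0 < r \<Longrightarrow> 0 \<in> interior (cball 0 r \<inter> DV M)"
  by (simp add: zero_in_interior_DV)

lemma convex_cball_DV: "convex (cball 0 r \<inter> DV M)"
  by (simp add: convex_DV convex_Int)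

text \<open>The segment from 0 to \<open>z\<close> stays in the cell and crosses the open shell
  between the two radii, so the convex cell has positive volume there.\<close>

lemma measure_cball_DV_strict_mono:
  assumes "0 \<le> r" "r < s" "z \<in> DV M" "r < norm z"
  shows "measure lebesgue (cball 0 r \<inter> DV M) < measure lebesgue (cball 0 s \<inter> DV M)"
proof -
  let ?C = "\<lambda>r. cball 0 r \<inter> DV M"
  define t where "t = min 1 ((r + s) / 2 / norm z)"
  have "0 < norm z"
    using assms by linarith
  then have t: "0 \<le> t" "t \<le> 1" "r < t * norm z" "t * norm z < s"
    using assms by (auto simp: t_def min_def field_simps)
  have "t *\<^sub>R z \<in> DV M"
    using convexD [OF convex_DV zero_in_DV assms(3), of "1 - t" t] t by simp
  then have ne: "t *\<^sub>R z \<in> (ball 0 s - cball 0 r) \<inter> DV M"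
    using t by simp
  have "0 < measure lebesgue (?C s - ?C r)"
  proof (rule measure_pos_convex [OF convex_DV, where U = "ball 0 s - cball 0 r"])
    show "?C s - ?C r \<in> lmeasurable"
      by (intro fmeasurable.Diff DV_cball_lmeasurable)
    show "interior (DV M) \<noteq> {}" "(ball 0 s - cball 0 r) \<inter> DV M \<noteq> {}"
      using zero_in_interior_DV ne by blast+
  qed auto
  also have "measure lebesgue (?C s - ?C r) = measure lebesgue (?C s) - measure lebesgue (?C r)"
    by (rule measurable_measure_Diff) (use assms DV_cball_lmeasurable in \<open>auto intro: fmeasurableD\<close>)
  finally show ?thesis
    by simp
qed

text \<open>Intermediate value theorem: the volume grows by at most the volume of the shell between
  the balls, hence is continuous in the radius.\<close>

lemma measure_cball_DV_attains:
  assumes "0 \<le> V" "V \<le> measure lebesgue (cball 0 R \<inter> DV M)" "0 \<le> R"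
  obtains r where "0 \<le> r" "r \<le> R" "measure lebesgue (cball 0 r \<inter> DV M) = V"
proof -
  define f where "f r = measure lebesgue (cball 0 r \<inter> DV M)" for r
  define g where "g r = measure lebesgue (cball 0 r :: (real^'n) set)" for r
  have g: "g r = r ^ CARD('n) * g 1" if "0 \<le> r" for r
    using content_ball_conv_unit_ball [OF that, of "0::real^'n"]
    by (simp add: g_def content_cball_conv_ball)
  have cont_g: "continuous_on {0..R} g"
  proof (rule continuous_on_eq)
    show "continuous_on {0..R} (\<lambda>r. r ^ CARD('n) * g 1)"
      by (intro continuous_intros)
    show "r ^ CARD('n) * g 1 = g r" if "r \<in> {0..R}" for r
      by (rule g [symmetric]) (use that in simp)
  qed
  have fg: "0 \<le> f s - f r \<and> f s - f r \<le> g s - g r" if "r \<le> s" for r s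
  proof -
    have sub: "(cball 0 s \<inter> DV M) - (cball 0 r \<inter> DV M) \<subseteq> cball 0 s - cball 0 r"
      by auto
    have "f s - f r = measure lebesgue ((cball 0 s \<inter> DV M) - (cball 0 r \<inter> DV M))"
      unfolding f_def
      by (rule measurable_measure_Diff [symmetric]) (use that DV_cball_lmeasurable in \<open>auto intro: fmeasurableD\<close>)
    also have "\<dots> \<le> measure lebesgue (cball 0 s - cball 0 r :: (real^'n) set)"
      by (intro measure_mono_fmeasurable sub fmeasurable.Diff fmeasurableD DV_cball_lmeasurable) auto
    also have "\<dots> = g s - g r"
      unfolding g_def by (rule measurable_measure_Diff) (use that in auto)
    finally have "f s - f r \<le> g s - g r" .
    moreover have "f r \<le> f s"
      unfolding f_def
      by (rule measure_mono_fmeasurable) (use that DV_cball_lmeasurable in \<open>auto intro: fmeasurableD\<close>)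
    ultimately show ?thesis
      by simp
  qed
  have "dist (f s) (f r) \<le> dist (g s) (g r)" for r s
    using fg [of r s] fg [of s r] by (cases "r \<le> s") (auto simp: dist_real_def)
  then have "continuous_on {0..R} f"
    using cont_g unfolding continuous_on_iff by (meson order_le_less_trans)
  moreover have "f 0 = 0"
    using zero_in_DV by (simp add: f_def)
  ultimately show thesis
    using IVT' [of f 0 V R] assms that unfolding f_def by auto
qed

text \<open>If \<open>q = u + q'\<close> with both points in the interior, symmetry and convexity
  put the midpoint of \<open>q\<close> and \<open>- q'\<close>, namely \<open>u/2\<close>, there as
  well.\<close>

lemma interior_packing:
  assumes "convex K" "K = uminus ` K"
    and half: "\<And>v. v \<in> M \<Longrightarrow> v \<noteq> 0 \<Longrightarrow> (1/2) *\<^sub>R v \<notin> interior K"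
    and u: "u \<in> M" "u \<noteq> 0"
  shows "interior K \<inter> (+) u ` interior K = {}"
proof (rule equals0I)
  fix q assume "q \<in> interior K \<inter> (+) u ` interior K"
  then obtain q' where q: "q \<in> interior K" "q' \<in> interior K" "q = u + q'"
    by blast
  have "interior K = uminus ` interior K"
    using assms(2) interior_negations by metis
  then have "- q' \<in> interior K"
    using q(2) by blast
  then have "(1/2) *\<^sub>R q + (1/2) *\<^sub>R (- q') \<in> interior K"
    by (intro convexD [OF convex_interior [OF assms(1)] q(1)]) auto
  moreover have "(1/2) *\<^sub>R q + (1/2) *\<^sub>R (- q') = (1/2) *\<^sub>R u"
    by (simp add: q(3) algebra_simps)
  ultimately show False
    using half u by simp
qed

lemma measure_interior:
  fixes K :: "(real^'n) set"
  assumes "convex K" "compact K"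
  shows "measure lebesgue (interior K) = measure lebesgue K"
proof -
  have "interior K \<in> lmeasurable"
    by (simp add: assms compact_imp_bounded convex_interior bounded_interior measurable_convex)
  moreover have "interior K - K \<union> (K - interior K) \<subseteq> frontier K"
    using interior_subset closure_subset by (auto simp: frontier_def)
  then have "negligible (interior K - K \<union> (K - interior K))"
    using negligible_convex_frontier [OF assms(1)] negligible_subset by blast
  ultimately show ?thesis
    using measure_negligible_symdiff [of "interior K" K] by simp
qed

lemma body_measure_le:
  assumes "convex K" "compact K" "K = uminus ` K" "K \<subseteq> cball 0 R"
    and "\<And>v. v \<in> M \<Longrightarrow> v \<noteq> 0 \<Longrightarrow> (1/2) *\<^sub>R v \<notin> interior K"
  obtains N where "finite N" "N \<subseteq> M"
    "measure lebesgue K \<le> measure lebesgue (cball 0 R \<inter> DV M \<inter> (\<Union>u\<in>N. (+) u ` interior K))"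
proof -
  obtain N where "finite N" "N \<subseteq> M"
    "measure lebesgue (interior K) \<le> measure lebesgue (cball 0 R \<inter> DV M \<inter> (\<Union>u\<in>N. (+) u ` interior K))"
  proof (rule measure_le_DV)
    show "interior K \<in> lmeasurable"
      by (simp add: assms(1,2) compact_imp_bounded convex_interior bounded_interior measurable_convex)
    show "interior K \<subseteq> cball 0 R"
      using assms(4) interior_subset by blast
    show "interior K \<inter> (+) u ` interior K = {}" if "u \<in> M" "u \<noteq> 0" for u
      using interior_packing [OF assms(1,3,5) that] .
  qed
  then show thesis
    by (intro that) (simp_all add: measure_interior [OF assms(1,2)])
qed

end

section \<open>Bodies of maximal volume in a ball\<close>

text \<open>The equality case of the volume bound: \<open>K\<close> fits into the ball of radius
  \<open>r\<close> and has the largest volume that the packing bound allows.\<close>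

locale extremal = discrete_cocompact M for M :: "(real^'n) set" +
  fixes K :: "(real^'n) set" and r :: real
  assumes convex_K: "convex K" and compact_K: "compact K" and sym: "K = uminus ` K"
    and K_cball: "K \<subseteq> cball 0 r" and r_pos: "0 < r"
    and half: "\<And>v. v \<in> M \<Longrightarrow> v \<noteq> 0 \<Longrightarrow> (1/2) *\<^sub>R v \<notin> interior K"
    and measure_K: "measure lebesgue K = measure lebesgue (cball 0 r \<inter> DV M)"
begin

lemma uminus_K: "x \<in> K \<Longrightarrow> - x \<in> K"
  using sym by blast

lemma interior_K: "interior K \<noteq> {}"
proof
  assume "interior K = {}"
  then have "measure lebesgue K = 0"
    using measure_interior [OF convex_K compact_K] by simp
  moreover have "0 < measure lebesgue (cball 0 r \<inter> DV M)"
    by (rule measure_pos_convex [OF convex_cball_DV [of r], of UNIV])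
      (use zero_in_interior_cball_DV [OF r_pos] DV_cball_lmeasurable interior_subset in blast)+
  ultimately show False
    using measure_K by simp
qed

lemma zero_in_K: "0 \<in> K"
proof -
  obtain x where "x \<in> K"
    using interior_K interior_subset by blast
  then show ?thesis
    using convexD [OF convex_K, of x "- x" "1/2" "1/2"] uminus_K by simp
qed

text \<open>Equality of volumes leaves at most a null set of the truncated cell uncovered, whereas
  an uncovered point would come with an uncovered part of positive measure.\<close>

lemma cover_cball_DV: "cball 0 r \<inter> DV M \<subseteq> (\<Union>u\<in>M. (+) u ` K)"
proof -
  let ?C = "cball 0 r \<inter> DV M"
  obtain N where N: "finite N" "N \<subseteq> M"
    "measure lebesgue K \<le> measure lebesgue (?C \<inter> (\<Union>u\<in>N. (+) u ` interior K))"
    using body_measure_le [OF convex_K compact_K sym K_cball half] by blast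
  \<comment> \<open>Closed translates replace the interiors, so that the finite union is compact and
    its complement open.\<close>
  let ?W = "\<Union>u\<in>N. (+) u ` K"
  have W: "compact ?W"
    using N(1) compact_K by (intro compact_UN compact_translation) auto
  have WM: "?C \<inter> ?W \<in> lmeasurable"
    by (rule fmeasurable.Int [OF DV_cball_lmeasurable lmeasurable_compact [OF W]])
  have "measure lebesgue (?C \<inter> (\<Union>u\<in>N. (+) u ` interior K)) \<le> measure lebesgue (?C \<inter> ?W)"
  proof (rule measure_mono_fmeasurable)
    have "open (\<Union>u\<in>N. (+) u ` interior K)"
      by (intro open_UN ballI open_translation open_interior)
    then have "(\<Union>u\<in>N. (+) u ` interior K) \<in> sets lebesgue"
      by (intro sets_completionI_sets) simp
    then show "?C \<inter> (\<Union>u\<in>N. (+) u ` interior K) \<in> sets lebesgue"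
      by (rule sets.Int [OF fmeasurableD [OF DV_cball_lmeasurable]])
    show "?C \<inter> (\<Union>u\<in>N. (+) u ` interior K) \<subseteq> ?C \<inter> ?W"
      using interior_subset by blast
  qed (rule WM)
  then have "measure lebesgue ?C \<le> measure lebesgue (?C \<inter> ?W)"
    using N(3) measure_K by simp
  moreover have "measure lebesgue (?C - ?C \<inter> ?W) = measure lebesgue ?C - measure lebesgue (?C \<inter> ?W)"
    by (rule measurable_measure_Diff [OF DV_cball_lmeasurable fmeasurableD [OF WM]]) blast
  ultimately have le: "measure lebesgue (?C - ?C \<inter> ?W) \<le> 0"
    by simp
  have "(- ?W) \<inter> ?C = {}"
  proof (rule ccontr)
    assume ne: "- ?W \<inter> ?C \<noteq> {}"
    have "0 < measure lebesgue (?C - ?C \<inter> ?W)"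
    proof (rule measure_pos_convex [OF convex_cball_DV])
      show "interior ?C \<noteq> {}"
        using zero_in_interior_cball_DV [OF r_pos] by blast
      show "open (- ?W)"
        using W compact_imp_closed by blast
      show "- ?W \<inter> ?C \<noteq> {}"
        by (rule ne)
      show "?C - ?C \<inter> ?W \<in> lmeasurable"
        by (intro fmeasurable.Diff DV_cball_lmeasurable fmeasurableD WM)
    qed blast
    then show False
      using le by simp
  qed
  then show ?thesis
    using N(2) by blast
qed

lemma cover_cball:
  assumes "norm x \<le> r"
  obtains u where "u \<in> M" "x - u \<in> K"
proof -
  obtain w where w: "w \<in> M" "x - w \<in> DV M"
    using reduce by blast
  have "norm (x - w) \<le> norm (x - w - (- w))"
    using w uminus unfolding DV_def by blast
  then have "x - w \<in> cball 0 r \<inter> DV M"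
    using w assms by simp
  then obtain u k where u: "u \<in> M" "k \<in> K" "x - w = u + k"
    using cover_cball_DV by blast
  then have "x - (u + w) = k"
    by (simp add: algebra_simps)
  then show thesis
    using that [of "u + w"] add u w by simp
qed

section \<open>Covering near the points of the sphere on a bisector\<close>

text \<open>For \<open>u\<close> of norm above \<open>2 * r\<close> the bound is the triangle
  inequality; for the finitely many others it persists near \<open>p\<close> by continuity.\<close>

lemma eventually_far:
  assumes lim: "(f \<longlongrightarrow> p) F" and r: "\<forall>\<^sub>F t in F. norm (f t) \<le> r"
    and p: "\<And>u. u \<in> M - X \<Longrightarrow> r < norm (p - u)"
  shows "\<forall>\<^sub>F t in F. \<forall>u \<in> M - X. r < norm (f t - u)"
proof -
  have fin: "finite ((M - X) \<inter> cball 0 (2 * r))"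
    by (rule finite_subset [OF _ finite_cball [of "2 * r"]]) blast
  have "\<forall>\<^sub>F t in F. r < norm (f t - u)" if "u \<in> M - X" for u
    by (rule order_tendstoD(1) [OF _ p [OF that]]) (intro tendsto_intros lim)
  then have "\<forall>\<^sub>F t in F. \<forall>u \<in> (M - X) \<inter> cball 0 (2 * r). r < norm (f t - u)"
    using fin by (intro eventually_ball_finite) blast+
  then show ?thesis
    using r
  proof eventually_elim
    case (elim t)
    show ?case
    proof
      fix u assume u: "u \<in> M - X"
      show "r < norm (f t - u)"
      proof (cases "norm u \<le> 2 * r")
        case False
        then show ?thesis
          using norm_triangle_ineq4 [of "f t" "f t - u"] elim(2) by simp
      qed (use elim(1) u in simp)
    qed
  qed
qed

text \<open>Pushing \<open>p\<close> slightly away from \<open>v\<close> makes \<open>0\<close> the only lattice point within distance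
  \<open>r\<close>, so that only \<open>K\<close> itself can cover the pushed point.\<close>

lemma sphere_point_in_K:
  assumes v: "v \<in> M" "v \<noteq> 0" and p: "norm p = r" "norm (p - v) = r"
    and far: "\<And>u. u \<in> M - {0, v} \<Longrightarrow> r < norm (p - u)"
  shows "p \<in> K"
proof (rule ccontr)
  assume "p \<notin> K"
  define x where "x t = p - t *\<^sub>R v" for t
  have pv: "v \<bullet> p = v \<bullet> v / 2"
    using p norm_le_diff_iff(3) [of p v] by simp
  \<comment> \<open>As \<open>p\<close> lies on the bisector, for \<open>0 < t < 1\<close> these
    formulas show \<open>x t\<close> inside the ball around 0 and outside the ball around
    \<open>v\<close>.\<close>
  have sq: "(norm (x t))\<^sup>2 = r\<^sup>2 - t * (1 - t) * (v \<bullet> v)"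
    "(norm (x t - v))\<^sup>2 = r\<^sup>2 + t * (1 + t) * (v \<bullet> v)" for t
  proof -
    have pp: "p \<bullet> p = r\<^sup>2" "p \<bullet> v = v \<bullet> v / 2"
      using p(1) pv by (simp_all add: inner_commute flip: power2_norm_eq_inner)
    show "(norm (x t))\<^sup>2 = r\<^sup>2 - t * (1 - t) * (v \<bullet> v)"
      "(norm (x t - v))\<^sup>2 = r\<^sup>2 + t * (1 + t) * (v \<bullet> v)"
      unfolding power2_norm_eq_inner x_def
      by (simp_all add: inner_diff_left inner_diff_right pv pp) (simp_all add: algebra_simps)
  qed
  have vv: "0 < v \<bullet> v"
    using v by simp
  have lim: "(x \<longlongrightarrow> p) (at_right 0)"
    unfolding x_def by (rule tendsto_eq_intros refl)+ simp
  have ev: "\<forall>\<^sub>F t in at_right 0. 0 < t \<and> t < (1::real)"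
    unfolding eventually_at_right_field by (intro exI [of _ 1]) simp
  then have le: "\<forall>\<^sub>F t in at_right 0. norm (x t) \<le> r"
  proof eventually_elim
    case (elim t)
    then have "(norm (x t))\<^sup>2 \<le> r\<^sup>2"
      using vv by (simp add: sq)
    then show ?case
      using r_pos by (simp add: power2_le_iff_abs_le)
  qed
  from ev have gt: "\<forall>\<^sub>F t in at_right 0. r < norm (x t - v)"
  proof eventually_elim
    case (elim t)
    then have "r\<^sup>2 < (norm (x t - v))\<^sup>2"
      using vv by (simp add: sq)
    then show ?case
      by (rule power2_less_imp_less) simp
  qed
  have notin: "\<forall>\<^sub>F t in at_right 0. x t \<in> - K"
    by (rule topological_tendstoD [OF lim])
      (use \<open>p \<notin> K\<close> compact_K compact_imp_closed in auto)
  have far': "\<forall>\<^sub>F t in at_right 0. \<forall>u \<in> M - {0, v}. r < norm (x t - u)"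
    by (rule eventually_far [OF lim le far])
  \<comment> \<open>Some translate of \<open>K\<close> contains \<open>x t\<close>, and the distance
    bounds force it to be \<open>K\<close> itself. The filter \<open>at_right 0\<close> is
    nontrivial, so this is a contradiction.\<close>
  have "\<forall>\<^sub>F t in at_right (0::real). False"
    using le gt notin far'
  proof eventually_elim
    case (elim t)
    obtain u where u: "u \<in> M" "x t - u \<in> K"
      using cover_cball [OF elim(1)] .
    then have "norm (x t - u) \<le> r"
      using K_cball by auto
    then have "u = 0"
      using elim(2,4) u(1) by force
    then show False
      using u elim(3) by simp
  qed
  then show False
    by simp
qed

text \<open>\<open>center\<close> puts \<open>v/2\<close> strictly inside the other half-spaces, and
  \<open>x\<close> is a facet point beyond the sphere. If \<open>v/2\<close> lies inside the ball,
  the sphere thus meets the relative interior of the facet, and the points found there identify a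
  supporting hyperplane of \<open>K\<close> at \<open>v/2\<close> with the bisector.\<close>

lemma facet_halfspace:
  assumes v: "v \<in> M" "v \<noteq> 0"
    and center: "\<And>u. u \<in> M \<Longrightarrow> u \<noteq> 0 \<Longrightarrow> u \<noteq> v \<Longrightarrow> u \<bullet> v < u \<bullet> u"
    and x: "x \<in> DV M" "v \<bullet> x = v \<bullet> v / 2" "r < norm x"
  shows "K \<subseteq> {y. v \<bullet> y \<le> v \<bullet> v / 2}"
proof (cases "norm v / 2 < r")
  case False
  show ?thesis
  proof
    fix y assume "y \<in> K"
    then have "norm y \<le> norm v / 2"
      using K_cball False by auto
    then have "v \<bullet> y \<le> norm v * (norm v / 2)"
      using norm_cauchy_schwarz [of v y] mult_left_mono [of "norm y" "norm v / 2" "norm v"] by simp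
    then show "y \<in> {y. v \<bullet> y \<le> v \<bullet> v / 2}"
      by (simp add: power2_norm_eq_inner flip: power2_eq_square)
  qed
next
  case True
  define c where "c = (1/2) *\<^sub>R v"
  have vc: "v \<bullet> c = v \<bullet> v / 2"
    by (simp add: c_def)
  obtain a where a: "a \<noteq> 0" "\<And>y. y \<in> K \<Longrightarrow> a \<bullet> y \<le> a \<bullet> c"
  proof -
    have "{c} \<inter> interior K = {}"
      using half v by (simp add: c_def)
    then obtain a b where ab: "a \<noteq> 0" "b \<le> a \<bullet> c" "\<And>y. y \<in> interior K \<Longrightarrow> a \<bullet> y \<le> b"
      using separating_hyperplane_sets [of "interior K" "{c}"] convex_interior [OF convex_K] interior_K
      by (auto simp: Int_commute)
    have "closure (interior K) \<subseteq> {y. a \<bullet> y \<le> b}"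
      by (rule closure_minimal) (use ab closed_halfspace_le in auto)
    then have "K \<subseteq> {y. a \<bullet> y \<le> b}"
      using convex_closure_interior [OF convex_K interior_K] closure_subset [of K] by blast
    then show thesis
      using that ab by fastforce
  qed
  \<comment> \<open>Both \<open>p\<close> and its reflection \<open>v - p\<close> lie in \<open>K\<close>, on opposite sides of the
    supporting hyperplane through \<open>v/2\<close>.\<close>
  have key: "a \<bullet> (p - c) = 0"
    if p: "norm p = r" "v \<bullet> p = v \<bullet> v / 2" and far: "\<And>u. u \<in> M - {0, v} \<Longrightarrow> r < norm (p - u)" for p
  proof -
    have pv: "norm (p - v) = r"
      using norm_le_diff_iff(3) [of p v] p by simp
    have "p \<in> K"
      by (rule sphere_point_in_K [OF v p(1) pv far])
    moreover have "v - p \<in> K"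
    proof (rule sphere_point_in_K [OF v])
      show "norm (v - p) = r" "norm (v - p - v) = r"
        using pv p(1) by (simp_all add: norm_minus_commute)
      fix u assume u: "u \<in> M - {0, v}"
      then have "r < norm (p - (v - u))"
        using diff v by (intro far) auto
      moreover have "p - (v - u) = - (v - p - u)"
        by simp
      ultimately show "r < norm (v - p - u)"
        by (metis norm_minus_cancel)
    qed
    ultimately have "a \<bullet> p \<le> a \<bullet> c" "a \<bullet> (v - p) \<le> a \<bullet> c"
      using a by blast+
    moreover have "a \<bullet> v = 2 * (a \<bullet> c)"
      by (simp add: c_def)
    ultimately show ?thesis
      by (simp add: inner_diff_right)
  qed
  obtain p where p: "norm p = r" "v \<bullet> p = v \<bullet> v / 2" "\<And>u. u \<in> M - {0, v} \<Longrightarrow> r < norm (p - u)"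
  proof -
    \<comment> \<open>Walk from the centre \<open>c\<close> to \<open>x\<close> until the sphere is
      reached. This happens before \<open>x\<close>, so the strict inequalities at \<open>c\<close>
      survive in the convex combination.\<close>
    define q where "q t = (1 - t) *\<^sub>R c + t *\<^sub>R x" for t :: real
    have "continuous_on {0..1} (\<lambda>t. norm (q t))"
      unfolding q_def by (intro continuous_intros)
    moreover have "norm (q 0) \<le> r" "r \<le> norm (q 1)"
      using True x(3) by (simp_all add: q_def c_def)
    ultimately obtain t where t: "0 \<le> t" "t \<le> 1" "norm (q t) = r"
      using IVT' [of "\<lambda>t. norm (q t)" 0 r 1] by auto
    have "t \<noteq> 1"
      using t(3) x(3) by (auto simp: q_def)
    have "r < norm (q t - u)" if u: "u \<in> M - {0, v}" for u
    proof -
      have "(1 - t) * (u \<bullet> c) < (1 - t) * (u \<bullet> u / 2)"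
        using center [of u] u t \<open>t \<noteq> 1\<close> by (intro mult_strict_left_mono) (auto simp: c_def)
      moreover have "t * (u \<bullet> x) \<le> t * (u \<bullet> u / 2)"
        using x(1) u t by (intro mult_left_mono) (auto simp: mem_DV)
      ultimately have "u \<bullet> q t < u \<bullet> u / 2"
        unfolding q_def by (simp add: inner_add_right left_diff_distrib)
      then show ?thesis
        using norm_le_diff_iff(2) [of "q t" u] t(3) by simp
    qed
    moreover have "v \<bullet> q t = v \<bullet> v / 2"
      unfolding q_def inner_add_right inner_scaleR_right vc x(2) by (simp only: flip: distrib_right) simp
    ultimately show thesis
      using that t(3) by blast
  qed
  define w where "w = p - c"
  have vw: "v \<bullet> w = 0" and aw: "a \<bullet> w = 0"
    using p vc key [OF p] by (simp_all add: w_def inner_diff_right)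
  have cw: "c \<bullet> w = 0"
    using vw by (simp add: c_def)
  have pp: "r\<^sup>2 = c \<bullet> c + w \<bullet> w"
  proof -
    have "r\<^sup>2 = (c + w) \<bullet> (c + w)"
      using p(1) by (simp add: w_def power2_norm_eq_inner flip: p(1))
    then show ?thesis
      using cw by (simp add: inner_add_left inner_add_right inner_commute)
  qed
  \<comment> \<open>\<open>w\<close> is a radius vector of the section of the sphere by the
    bisector; it is nonzero because \<open>c\<close> lies inside the ball.\<close>
  have w0: "norm w \<noteq> 0"
  proof
    assume "norm w = 0"
    then have "p = c"
      by (simp add: w_def)
    then show False
      using p(1) True by (simp add: c_def)
  qed
  have perp: "a \<bullet> h = 0" if h: "v \<bullet> h = 0" for h
  proof -
    \<comment> \<open>The curve \<open>f\<close> turns \<open>p\<close> towards \<open>h\<close>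
      within this section: rescaling \<open>g t\<close> to the length of \<open>w\<close> keeps
      \<open>f t\<close> on the sphere and the bisector. For small \<open>t\<close> then
      \<open>key\<close> applies, and \<open>a \<bullet> w = 0\<close> leaves
      \<open>a \<bullet> h = 0\<close>.\<close>
    define g where "g t = w + t *\<^sub>R h" for t :: real
    define f where "f t = c + (norm w / norm (g t)) *\<^sub>R g t" for t
    have g: "(g \<longlongrightarrow> w) (at_right 0)"
      unfolding g_def by (rule tendsto_eq_intros refl)+ simp
    have f: "(f \<longlongrightarrow> p) (at_right 0)"
      unfolding f_def by (rule tendsto_eq_intros refl g w0)+ (use w0 in \<open>simp add: w_def\<close>)
    have vg: "v \<bullet> g t = 0" "c \<bullet> g t = 0" for t
      using vw cw h by (simp_all add: g_def c_def inner_add_right)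
    have g0: "\<forall>\<^sub>F t in at_right 0. g t \<noteq> 0"
      by (rule tendsto_imp_eventually_ne [OF g]) (use w0 in simp)
    have fr: "norm (f t) = r" if "g t \<noteq> 0" for t
    proof -
      have "(norm (f t))\<^sup>2 = c \<bullet> c + (norm w / norm (g t))\<^sup>2 * (g t \<bullet> g t)"
        unfolding power2_norm_eq_inner f_def
        using vg(2) [of t] by (simp add: inner_add_left inner_add_right inner_commute power2_eq_square)
      also have "(norm w / norm (g t))\<^sup>2 * (g t \<bullet> g t) = w \<bullet> w"
        using that by (simp add: power_divide flip: power2_norm_eq_inner)
      finally have "(norm (f t))\<^sup>2 = r\<^sup>2"
        using pp by simp
      then show ?thesis
        using r_pos by (simp add: power2_eq_iff_nonneg)
    qed
    have "\<forall>\<^sub>F t in at_right 0. norm (f t) \<le> r"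
      using g0 by eventually_elim (simp add: fr)
    then have "\<forall>\<^sub>F t in at_right 0. \<forall>u\<in>M - {0, v}. r < norm (f t - u)"
      by (rule eventually_far [OF f]) (rule p(3))
    moreover have "\<forall>\<^sub>F t in at_right 0. 0 < (t::real)"
      by (rule eventually_at_right_less)
    ultimately have "\<forall>\<^sub>F t in at_right (0::real). a \<bullet> h = 0"
      using g0
    proof eventually_elim
      case (elim t)
      have "a \<bullet> (f t - c) = 0"
        using elim by (intro key fr) (auto simp: f_def inner_add_right vc vg)
      then have "a \<bullet> g t = 0"
        using elim(3) w0 by (simp add: f_def)
      then show ?case
        using aw elim(2) by (simp add: g_def inner_add_right)
    qed
    then show ?thesis
      by simp
  qed
  \<comment> \<open>\<open>\<kappa>\<close> is the coefficient of the projection of \<open>a\<close>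
    onto \<open>v\<close>. The remainder \<open>h\<close> is orthogonal to \<open>v\<close>, hence
    to \<open>a\<close>, hence to itself.\<close>
  define \<kappa> where "\<kappa> = (v \<bullet> a) / (v \<bullet> v)"
  have vv: "0 < v \<bullet> v"
    using v by simp
  define h where "h = a - \<kappa> *\<^sub>R v"
  have "v \<bullet> h = 0"
    using vv by (simp add: h_def \<kappa>_def inner_diff_right)
  then have "h \<bullet> h = 0"
    using perp [of h] by (simp add: h_def inner_diff_left inner_commute)
  then have av: "a = \<kappa> *\<^sub>R v"
    by (simp add: h_def)
  \<comment> \<open>The supporting inequality at the point 0 of \<open>K\<close> fixes the
    sign.\<close>
  have "0 \<le> \<kappa>"
    using a(2) [OF zero_in_K] vv unfolding av by (simp add: vc zero_le_mult_iff)
  then have "0 < \<kappa>"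
    using a(1) av by (cases "\<kappa> = 0") auto
  show ?thesis
  proof
    fix y assume "y \<in> K"
    then have "\<kappa> * (v \<bullet> y) \<le> \<kappa> * (v \<bullet> v / 2)"
      using a(2) [of y] unfolding av by (simp add: vc)
    then show "y \<in> {y. v \<bullet> y \<le> v \<bullet> v / 2}"
      using \<open>0 < \<kappa>\<close> by simp
  qed
qed

text \<open>If \<open>K\<close> left the cell, the segment from 0 to an outer point would cross the
  boundary in a facet, whose half-space contains \<open>K\<close>. Given the inclusion, equal
  volumes and closedness of \<open>K\<close> yield equality.\<close>

lemma eq_cball_DV:
  assumes facets: "\<And>F. F facet_of DV M \<Longrightarrow> \<exists>x\<in>F. r < norm x"
  shows "K = cball 0 r \<inter> DV M"
proof -
  let ?C = "cball 0 r \<inter> DV M"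
  have "K \<subseteq> DV M"
  proof
    fix y assume y: "y \<in> K"
    show "y \<in> DV M"
    proof (rule ccontr)
      assume ny: "y \<notin> DV M"
      have "closed_segment 0 y \<inter> frontier (DV M) \<noteq> {}"
        by (rule connected_Int_frontier) (use ny zero_in_DV in auto)
      then obtain t where t: "0 \<le> t" "t \<le> 1" "t *\<^sub>R y \<in> frontier (DV M)"
        by (auto simp: in_segment)
      have "frontier (DV M) = DV M - rel_interior (DV M)"
        using zero_in_interior_DV rel_interior_nonempty_interior [of "DV M"]
          closure_closed [OF compact_imp_closed [OF compact_DV]] by (auto simp only: frontier_def)
      then obtain F where F: "F facet_of DV M" "t *\<^sub>R y \<in> F"
        using t(3) rel_boundary_of_polyhedron [OF polyhedron_DV] by auto
      then have FP: "F \<subseteq> DV M"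
        using facet_of_imp_subset by blast
      obtain v where v: "v \<in> M" "v \<noteq> 0" "F \<subseteq> {x. v \<bullet> x = v \<bullet> v / 2}"
        "\<And>u. u \<in> M \<Longrightarrow> u \<noteq> 0 \<Longrightarrow> u \<noteq> v \<Longrightarrow> u \<bullet> v < u \<bullet> u"
        using facet_bisector [OF F(1)] by metis
      obtain x where x: "x \<in> F" "r < norm x"
        using facets [OF F(1)] by blast
      have "K \<subseteq> {y. v \<bullet> y \<le> v \<bullet> v / 2}"
        by (rule facet_halfspace [OF v(1,2,4)]) (use x v(3) FP in auto)
      then have le: "v \<bullet> y \<le> v \<bullet> v / 2"
        using y by blast
      \<comment> \<open>\<open>y\<close> satisfies the inequality that \<open>t *\<^sub>R y\<close>
        attains, so with \<open>t \<le> 1\<close> the crossing point is \<open>y\<close>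
        itself.\<close>
      have eq: "t * (v \<bullet> y) = v \<bullet> v / 2"
        using F(2) v(3) by auto
      have "0 < v \<bullet> v"
        using v by simp
      then have "0 < t * (v \<bullet> y)"
        using eq by linarith
      then have "0 < v \<bullet> y"
        using t(1) by (simp add: zero_less_mult_iff)
      moreover have "v \<bullet> y \<le> t * (v \<bullet> y)"
        using le eq by linarith
      ultimately have "t = 1"
        using t(2) by simp
      then show False
        using F(2) FP ny by auto
    qed
  qed
  then have sub: "K \<subseteq> ?C"
    using K_cball by blast
  have Km: "K \<in> lmeasurable"
    by (rule lmeasurable_compact [OF compact_K])
  have "measure lebesgue (?C - K) = measure lebesgue ?C - measure lebesgue K"
    by (rule measurable_measure_Diff [OF DV_cball_lmeasurable fmeasurableD [OF Km] sub])
  then have 0: "measure lebesgue (?C - K) = 0"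
    using measure_K by simp
  have "- K \<inter> ?C = {}"
  proof (rule ccontr)
    assume ne: "- K \<inter> ?C \<noteq> {}"
    have "0 < measure lebesgue (?C - K)"
    proof (rule measure_pos_convex [OF convex_cball_DV])
      show "interior ?C \<noteq> {}"
        using zero_in_interior_cball_DV [OF r_pos] by blast
      show "open (- K)"
        using compact_K compact_imp_closed by blast
      show "- K \<inter> ?C \<noteq> {}"
        by (rule ne)
      show "?C - K \<in> lmeasurable"
        by (intro fmeasurable.Diff DV_cball_lmeasurable fmeasurableD Km)
    qed blast
    then show False
      using 0 by simp
  qed
  then show ?thesis
    using sub by blast
qed

end

section \<open>Lattices given by a matrix\<close>

lemma diameter_symmetric:
  fixes K :: "'a::euclidean_space set"
  assumes "bounded K" "K = uminus ` K"
  shows "K \<subseteq> cball 0 (diameter K / 2)"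
proof
  fix x assume "x \<in> K"
  moreover from this have "- x \<in> K"
    using assms(2) by blast
  ultimately have "norm (x - (- x)) \<le> diameter K"
    using diameter_bounded_bound [OF assms(1)] by (simp only: dist_norm)
  moreover have "norm (x - (- x)) = 2 * norm x"
    by (simp flip: scaleR_2)
  ultimately show "x \<in> cball 0 (diameter K / 2)"
    by simp
qed

lemma finite_bounded_integer_vectors:
  "finite {z :: real^'n. \<forall>i. z $ i \<in> \<int> \<and> \<bar>z $ i\<bar> \<le> B}"
proof -
  let ?T = "{k \<in> \<int>. \<bar>k\<bar> \<le> B}"
  have "finite (vec_lambda ` (UNIV \<rightarrow>\<^sub>E ?T :: ('n \<Rightarrow> real) set))"
    by (intro finite_imageI finite_PiE finite_abs_int_segment) simp
  moreover have "{z :: real^'n. \<forall>i. z $ i \<in> \<int> \<and> \<bar>z $ i\<bar> \<le> B} \<subseteq> vec_lambda ` (UNIV \<rightarrow>\<^sub>E ?T)"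
  proof
    fix z :: "real^'n" assume "z \<in> {z. \<forall>i. z $ i \<in> \<int> \<and> \<bar>z $ i\<bar> \<le> B}"
    then show "z \<in> vec_lambda ` (UNIV \<rightarrow>\<^sub>E ?T)"
      by (intro image_eqI [of _ _ "vec_nth z"]) (auto simp: vec_lambda_eta)
  qed
  ultimately show ?thesis
    by (rule finite_subset [rotated])
qed

locale matrix_lattice =
  fixes A :: "real^'n^'n"
  assumes inv: "invertible A"
begin

abbreviation "L \<equiv> lattice_of_matrix A"

lemma double_eq: "double L = {2 *\<^sub>R (A *v z) | z. \<forall>i. z $ i \<in> \<int>}"
  by (auto simp: double_def lattice_of_matrix_def)

lemma mult_eq_zero_iff: "A *v x = 0 \<longleftrightarrow> x = 0"
  using inv by (metis invertible_def matrix_vector_mul_assoc matrix_vector_mul_lid matrix_vector_mult_0_right)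

text \<open>Discreteness: the inverse matrix is bounded, so lattice points in a ball have bounded
  integer coordinates. Cocompactness: round coordinates down.\<close>

sublocale discrete_cocompact "double L"
proof
  show "0 \<in> double L"
    unfolding double_eq by (rule CollectI) (rule exI [of _ 0], simp)
  show "u - v \<in> double L" if uv: "u \<in> double L" "v \<in> double L" for u v
  proof -
    obtain y z where "u = 2 *\<^sub>R (A *v y)" "v = 2 *\<^sub>R (A *v z)" "\<And>i. y $ i \<in> \<int>" "\<And>i. z $ i \<in> \<int>"
      using uv unfolding double_eq by blast
    then show ?thesis
      unfolding double_eq
      by (intro CollectI exI [of _ "y - z"]) (simp add: matrix_vector_mult_diff_distrib scaleR_diff_right)
  qed
  obtain B where B: "A ** B = mat 1" "B ** A = mat 1"
    using inv by (auto simp: invertible_def)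
  show "finite (double L \<inter> cball 0 R)" for R
  proof -
    obtain b where b: "0 < b" "\<And>x. norm (B *v x) \<le> b * norm x"
      using linear_bounded_pos [OF matrix_vector_mul_linear [of B]] by (auto simp: mult.commute)
    have "double L \<inter> cball 0 R \<subseteq> (\<lambda>z. 2 *\<^sub>R (A *v z)) ` {z. \<forall>i. z $ i \<in> \<int> \<and> \<bar>z $ i\<bar> \<le> b * R}"
    proof
      fix u assume u: "u \<in> double L \<inter> cball 0 R"
      then obtain z where z: "u = 2 *\<^sub>R (A *v z)" "\<And>i. z $ i \<in> \<int>"
        unfolding double_eq by blast
      have "\<bar>z $ i\<bar> \<le> b * R" for i
      proof -
        have "2 * norm (A *v z) \<le> R"
          using u z(1) by simp
        then have "norm (A *v z) \<le> R"
          using norm_ge_zero [of "A *v z"] by linarith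
        have "\<bar>z $ i\<bar> \<le> norm z"
          by (rule component_le_norm_cart)
        also have "norm z = norm (B *v (A *v z))"
          by (simp add: matrix_vector_mul_assoc B)
        also have "norm (B *v (A *v z)) \<le> b * norm (A *v z)"
          by (rule b)
        also have "\<dots> \<le> b * R"
          using b \<open>norm (A *v z) \<le> R\<close> by simp
        finally show ?thesis .
      qed
      then show "u \<in> (\<lambda>z. 2 *\<^sub>R (A *v z)) ` {z. \<forall>i. z $ i \<in> \<int> \<and> \<bar>z $ i\<bar> \<le> b * R}"
        using z by blast
    qed
    then show ?thesis
      using finite_bounded_integer_vectors finite_subset finite_imageI by blast
  qed
  obtain b where b: "0 < b" "\<And>x. norm (A *v x) \<le> b * norm x"
    using linear_bounded_pos [OF matrix_vector_mul_linear [of A]] by (auto simp: mult.commute)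
  show "\<exists>R. \<forall>x. \<exists>u\<in>double L. norm (x - u) \<le> R"
  proof (intro exI allI)
    fix x
    define y where "y = (1/2) *\<^sub>R (B *v x)"
    define z :: "real^'n" where "z = (\<chi> i. of_int \<lfloor>y $ i\<rfloor>)"
    have x: "x = 2 *\<^sub>R (A *v y)"
      by (simp add: y_def matrix_vector_mult_scaleR matrix_vector_mul_assoc B)
    have "norm (y - z) \<le> (\<Sum>i\<in>UNIV. \<bar>(y - z) $ i\<bar>)"
      by (rule norm_le_l1_cart)
    also have "\<dots> \<le> (\<Sum>i\<in>(UNIV :: 'n set). 1)"
    proof (rule sum_mono)
      show "\<bar>(y - z) $ i\<bar> \<le> 1" for i
        using floor_correct [of "y $ i"] by (simp add: z_def) linarith
    qed
    finally have yz: "norm (y - z) \<le> CARD('n)"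
      by simp
    have "x - 2 *\<^sub>R (A *v z) = 2 *\<^sub>R (A *v (y - z))"
      by (simp add: x matrix_vector_mult_diff_distrib scaleR_diff_right)
    then have "norm (x - 2 *\<^sub>R (A *v z)) = 2 * norm (A *v (y - z))"
      by simp
    also have "\<dots> \<le> 2 * (b * CARD('n))"
      using b(2) [of "y - z"] mult_left_mono [OF yz, of b] b(1) by linarith
    finally show "\<exists>u\<in>double L. norm (x - u) \<le> 2 * (b * CARD('n))"
      unfolding double_eq by (intro bexI) (auto simp: z_def)
  qed
qed

section \<open>Covering radius, volume of the cell and the radius \<open>r_of\<close>\<close>

text \<open>After doubling, balls of radius \<open>\<mu>\<close> around \<open>L\<close> cover space
  iff the cell of \<open>2L\<close> lies in the ball of radius \<open>2 * \<mu>\<close>. A point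
  \<open>z\<close> of largest norm in the cell thus determines the least
  \<open>\<mu>\<close>.\<close>

lemma covering_radius_DV:
  obtains z where "z \<in> DV (double L)" "norm z = 2 * covering_radius L"
    "DV (double L) \<subseteq> cball 0 (2 * covering_radius L)"
proof -
  obtain z where z: "z \<in> DV (double L)" "\<And>x. x \<in> DV (double L) \<Longrightarrow> norm x \<le> norm z"
    using continuous_attains_sup [OF compact_DV _ continuous_on_norm_id] zero_in_DV by auto
  have covers: "{x + b |x b. x \<in> L \<and> b \<in> cball 0 \<mu>} = UNIV \<longleftrightarrow> norm z / 2 \<le> \<mu>" for \<mu>
  proof
    assume cov: "{x + b |x b. x \<in> L \<and> b \<in> cball 0 \<mu>} = UNIV"
    have "\<exists>u\<in>double L. norm (y - u) \<le> 2 * \<mu>" for y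
    proof -
      have "(1/2) *\<^sub>R y \<in> {x + b |x b. x \<in> L \<and> b \<in> cball 0 \<mu>}"
        unfolding cov by simp
      then obtain x b where xb: "x \<in> L" "b \<in> cball 0 \<mu>" "(1/2) *\<^sub>R y = x + b"
        by blast
      have "y = 2 *\<^sub>R ((1/2) *\<^sub>R y)"
        by simp
      then have "y - 2 *\<^sub>R x = 2 *\<^sub>R b"
        unfolding xb(3) by (simp add: scaleR_add_right)
      then have "norm (y - 2 *\<^sub>R x) \<le> 2 * \<mu>"
        using xb(2) by simp
      then show ?thesis
        using xb(1) unfolding double_def by blast
    qed
    then have "DV (double L) \<subseteq> cball 0 (2 * \<mu>)"
      by (rule DV_subset_cball)
    then show "norm z / 2 \<le> \<mu>"
      using z(1) by auto
  next
    assume \<mu>: "norm z / 2 \<le> \<mu>"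
    have "y \<in> {x + b |x b. x \<in> L \<and> b \<in> cball 0 \<mu>}" for y
    proof -
      obtain u where u: "u \<in> L" "2 *\<^sub>R y - 2 *\<^sub>R u \<in> DV (double L)"
        using reduce [of "2 *\<^sub>R y"] by (auto simp: double_def)
      have "norm (2 *\<^sub>R (y - u)) \<le> norm z"
        using z(2) [OF u(2)] by (simp only: scaleR_diff_right)
      then have "y - u \<in> cball 0 \<mu>"
        using \<mu> by simp
      then show ?thesis
        using u(1) by (intro CollectI exI [of _ u] exI [of _ "y - u"]) simp
    qed
    then show "{x + b |x b. x \<in> L \<and> b \<in> cball 0 \<mu>} = UNIV"
      by blast
  qed
  have "covering_radius L = norm z / 2"
    unfolding covering_radius_def covers by (rule Least_equality) auto
  then have cr: "2 * covering_radius L = norm z"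
    by simp
  show thesis
    by (rule that [of z, unfolded cr]) (use z in auto)
qed

text \<open>The open fundamental parallelepiped of \<open>2L\<close> has disjoint translates, so the
  packing bound applies to it. This lets every \<open>V\<close> in the range be attained by a
  radius.\<close>

lemma volume_le_DV:
  "2 ^ CARD('n) * lattice_det L \<le> measure lebesgue (cball 0 (2 * covering_radius L) \<inter> DV (double L))"
proof -
  let ?f = "\<lambda>z. 2 *\<^sub>R (A *v z)"
  let ?B = "box 0 One :: (real^'n) set"
  define Q where "Q = ?f ` ?B"
  have img: "Q = (*\<^sub>R) 2 ` ((*v) A) ` ?B"
    by (auto simp: Q_def)
  have B: "?B \<in> lmeasurable" "measure lebesgue ?B = 1"
    by (simp_all add: measure_lborel_box_eq)
  have A: "((*v) A) ` ?B \<in> lmeasurable" "measure lebesgue (((*v) A) ` ?B) = \<bar>det A\<bar>"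
    using linear_image_lebesgue [OF matrix_vector_mul_linear [of A] B(1)] B(2) by auto
  have Q: "Q \<in> lmeasurable" "measure lebesgue Q = 2 ^ CARD('n) * lattice_det L"
    using linear_image_lebesgue [OF linear_scaleR [of 2] A(1)] A(2) lattice_det_eq [OF inv]
    unfolding img by auto
  have disj: "Q \<inter> (+) u ` Q = {}" if u: "u \<in> double L" "u \<noteq> 0" for u
  proof (rule equals0I)
    fix x assume "x \<in> Q \<inter> (+) u ` Q"
    then obtain q q' where q: "q \<in> ?B" "q' \<in> ?B" "2 *\<^sub>R (A *v q) = u + 2 *\<^sub>R (A *v q')"
      unfolding Q_def by auto
    obtain z where z: "u = 2 *\<^sub>R (A *v z)" "\<And>i. z $ i \<in> \<int>"
      using u unfolding double_eq by blast
    have "A *v (q - (z + q')) = 0"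
      using q(3) unfolding z(1) scaleR_add_right [symmetric]
      by (simp add: matrix_vector_mult_diff_distrib matrix_vector_right_distrib)
    then have "q = z + q'"
      by (simp add: mult_eq_zero_iff)
    moreover have one: "(One :: real^'n) $ i = 1" for i
      by (simp add: cart_eq_inner_axis axis_in_Basis_iff inner_sum_left inner_Basis)
    ultimately have "0 < z $ i + q' $ i" "z $ i + q' $ i < 1" "0 < q' $ i" "q' $ i < 1" for i
      using q(1,2) unfolding mem_box_cart one by auto
    \<comment> \<open>Points of the open unit cube differ by less than 1 in each coordinate, so the
      integer coordinates of \<open>z\<close> vanish.\<close>
    then have "\<bar>z $ i\<bar> < 1" for i
      by (smt (verit))
    then have "z $ i = 0" for i
      using z(2) [of i] Ints_nonzero_abs_less1 by blast
    then have "z = 0"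
      by (simp add: vec_eq_iff)
    then have "u = 0"
      unfolding z(1) by simp
    then show False
      using u by simp
  qed
  have DV_sub: "DV (double L) \<subseteq> cball 0 (2 * covering_radius L)"
    by (rule covering_radius_DV)
  have "bounded Q"
    unfolding img by (intro bounded_linear_image bounded_box matrix_vector_mul_bounded_linear bounded_linear_scaleR_right)
  then obtain R where R: "Q \<subseteq> cball 0 R"
    unfolding bounded_iff by (metis mem_cball_0 subsetI)
  obtain N where "finite N"
    and "measure lebesgue Q \<le> measure lebesgue (cball 0 R \<inter> DV (double L) \<inter> (\<Union>u\<in>N. (+) u ` Q))"
  proof (rule measure_le_DV [OF Q(1) R])
    show "Q \<inter> (+) u ` Q = {}" if "u \<in> double L" "u \<noteq> 0" for u
      using disj that .
  qed
  note this(2)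
  also have "measure lebesgue (cball 0 R \<inter> DV (double L) \<inter> (\<Union>u\<in>N. (+) u ` Q))
      \<le> measure lebesgue (cball 0 (2 * covering_radius L) \<inter> DV (double L))"
  proof (rule measure_mono_fmeasurable)
    show "cball 0 R \<inter> DV (double L) \<inter> (\<Union>u\<in>N. (+) u ` Q) \<subseteq> cball 0 (2 * covering_radius L) \<inter> DV (double L)"
      using DV_sub by blast
    show "cball 0 R \<inter> DV (double L) \<inter> (\<Union>u\<in>N. (+) u ` Q) \<in> sets lebesgue"
      by (intro fmeasurableD fmeasurable.Int DV_cball_lmeasurable fmeasurable.finite_UN \<open>finite N\<close>
          measurable_translation Q)
  qed (rule DV_cball_lmeasurable)
  finally show ?thesis
    using Q(2) by simp
qed

text \<open>Existence is the intermediate value property; uniqueness is strict monotonicity up to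
  \<open>2 * covering_radius L\<close>, the norm of a farthest point of the cell.\<close>

lemma r_of_properties:
  assumes "0 < V" "V \<le> 2 ^ CARD('n) * lattice_det L"
  shows "0 < r_of L V" "r_of L V \<le> 2 * covering_radius L"
    "measure lebesgue (cball 0 (r_of L V) \<inter> DV (double L)) = V"
proof -
  let ?P = "\<lambda>r. 0 < r \<and> r \<le> 2 * covering_radius L \<and> measure lborel (cball 0 r \<inter> DV (double L)) = V"
  have leb: "measure lborel (cball 0 r \<inter> DV (double L)) = measure lebesgue (cball 0 r \<inter> DV (double L))" for r
    by (simp add: compact_DV compact_Int borel_compact)
  obtain z where z: "z \<in> DV (double L)" "norm z = 2 * covering_radius L"
    by (rule covering_radius_DV)
  have "0 \<le> 2 * covering_radius L"
    using norm_ge_zero [of z] z(2) by linarith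
  moreover have "V \<le> measure lebesgue (cball 0 (2 * covering_radius L) \<inter> DV (double L))"
    using volume_le_DV assms(2) by linarith
  ultimately obtain r where r: "0 \<le> r" "r \<le> 2 * covering_radius L"
      "measure lebesgue (cball 0 r \<inter> DV (double L)) = V"
    using assms(1) measure_cball_DV_attains [of V "2 * covering_radius L"] by auto
  have "r \<noteq> 0"
    using r(3) assms(1) zero_in_DV by auto
  then have "?P r"
    using r leb by simp
  moreover have "s = r" if "?P s" for s
  proof (rule ccontr)
    assume "s \<noteq> r"
    then consider "s < r" | "r < s"
      by linarith
    then show False
      using measure_cball_DV_strict_mono [of s r z] measure_cball_DV_strict_mono [of r s z]
        z that r leb by cases auto
  qed
  ultimately have "?P (r_of L V)"
    unfolding r_of_def by (rule theI [of ?P])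
  then show "0 < r_of L V" "r_of L V \<le> 2 * covering_radius L"
    "measure lebesgue (cball 0 (r_of L V) \<inter> DV (double L)) = V"
    using leb by auto
qed

lemma half_double: "v \<in> double L \<Longrightarrow> v \<noteq> 0 \<Longrightarrow> (1/2) *\<^sub>R v \<in> L - {0}"
  by (auto simp: double_def)

text \<open>A nonzero \<open>x\<close> in \<open>L\<close> is half of the vector
  \<open>2 *\<^sub>R x\<close> of \<open>double L\<close>, hence never interior to the cell.\<close>

lemma K_of_admissible: "K_of L V \<in> admissible_bodies L"
proof -
  have "x \<notin> interior (K_of L V)" if "x \<in> L" "x \<noteq> 0" for x
  proof
    assume "x \<in> interior (K_of L V)"
    then have "x \<in> interior (DV (double L))"
      by (simp add: K_of_def)
    moreover have "2 *\<^sub>R x \<in> double L"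
      using that by (simp add: double_def)
    ultimately show False
      using half_not_interior_DV [of "2 *\<^sub>R x"] that by simp
  qed
  moreover have sub: "uminus ` K_of L V \<subseteq> K_of L V"
    using uminus_DV by (auto simp: K_of_def)
  have "K_of L V = uminus ` K_of L V"
  proof
    show "K_of L V \<subseteq> uminus ` K_of L V"
      using image_mono [OF sub, of uminus] by (simp add: image_image)
  qed (rule sub)
  ultimately show ?thesis
    unfolding admissible_bodies_def K_of_def
    by (intro CollectI conjI convex_cball_DV compact_Int compact_cball compact_DV) (auto simp: K_of_def)
qed

end

section \<open>Extremality and uniqueness of the truncated cell\<close>

theorem corollary4p3:
  fixes L :: "(real^'n) set" and D V :: real
  assumes "CARD('n) \<ge> 2"
    and "is_lattice L"
    and "0 < D" and "D \<le> 4 * covering_radius L"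
    and "0 < V" and "V \<le> 2 ^ CARD('n) * lattice_det L"
    and "2 * r_of L V = D"
    and "\<And>F. F facet_of DV (double L) \<Longrightarrow>
           \<exists>x. x extreme_point_of DV (double L) \<and> x \<in> F \<and> norm x > r_of L V"
  shows "extremal_body L V (K_of L V) \<and> (\<forall>K. extremal_body L V K \<longrightarrow> K = K_of L V)"
proof -
  obtain A where A: "invertible A" "L = lattice_of_matrix A"
    using assms(2) by (auto simp: is_lattice_def)
  interpret matrix_lattice A
    by standard (rule A)
  note L = A(2)
  let ?r = "r_of L V"
  have r: "0 < ?r" "?r \<le> 2 * covering_radius L"
    and vol: "measure lebesgue (cball 0 ?r \<inter> DV (double L)) = V"
    using r_of_properties [of V] assms(5,6) unfolding L by blast+
  have adm: "K_of L V \<in> admissible_bodies L"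
    unfolding L by (rule K_of_admissible)
  have vol_K: "measure lborel (K_of L V) = V"
    using vol compact_DV unfolding K_of_def L by (simp add: compact_Int borel_compact)
  have diam_K: "diameter (K_of L V) \<le> 2 * ?r"
  proof (rule diameter_le)
    show "K_of L V \<noteq> {} \<or> 0 \<le> 2 * ?r"
      using r by simp
    show "norm (x - y) \<le> 2 * ?r" if "x \<in> K_of L V" "y \<in> K_of L V" for x y
      using that norm_triangle_ineq4 [of x y] by (simp add: K_of_def)
  qed
  have body: "compact K" "convex K" "K = uminus ` K" "measure lebesgue K = V"
      "\<And>v. v \<in> double L \<Longrightarrow> v \<noteq> 0 \<Longrightarrow> (1/2) *\<^sub>R v \<notin> interior K"
    if K: "K \<in> admissible_bodies L" "measure lborel K = V" for K
  proof -
    show "compact K" "convex K" "K = uminus ` K"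
      using K(1) unfolding admissible_bodies_def by blast+
    then show "measure lebesgue K = V"
      using K(2) by (simp add: borel_compact)
    show "(1/2) *\<^sub>R v \<notin> interior K" if "v \<in> double L" "v \<noteq> 0" for v
      using K(1) half_double [of v] that unfolding admissible_bodies_def L by blast
  qed
  \<comment> \<open>A body of smaller diameter fits into a ball of radius \<open>R < ?r\<close>,
    where the packing bound leaves less volume than \<open>V\<close> because the cell reaches beyond
    radius \<open>R\<close>.\<close>
  have minimal: "2 * ?r \<le> diameter K" if K: "K \<in> admissible_bodies L" "measure lborel K = V" for K
  proof (rule ccontr)
    assume "\<not> 2 * ?r \<le> diameter K"
    define R where "R = diameter K / 2"
    have R: "0 \<le> R" "R < ?r"
      using \<open>\<not> 2 * ?r \<le> diameter K\<close> diameter_ge_0 [OF compact_imp_bounded [OF body(1) [OF K]]]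
      by (auto simp: R_def)
    have sub: "K \<subseteq> cball 0 R"
      unfolding R_def by (rule diameter_symmetric [OF compact_imp_bounded [OF body(1) [OF K]] body(3) [OF K]])
    have half: "(1/2) *\<^sub>R v \<notin> interior K" if "v \<in> double (lattice_of_matrix A)" "v \<noteq> 0" for v
      using body(5) [OF K] that unfolding L by blast
    obtain N where N: "finite N" "measure lebesgue K \<le>
        measure lebesgue (cball 0 R \<inter> DV (double L) \<inter> (\<Union>u\<in>N. (+) u ` interior K))"
      using body_measure_le [OF body(2,1,3) [OF K] sub half] unfolding L by blast
    have "measure lebesgue (cball 0 R \<inter> DV (double L) \<inter> (\<Union>u\<in>N. (+) u ` interior K))
        \<le> measure lebesgue (cball 0 R \<inter> DV (double L))"
    proof (rule measure_mono_fmeasurable)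
      have "open (\<Union>u\<in>N. (+) u ` interior K)"
        by (intro open_UN ballI open_translation open_interior)
      then have "(\<Union>u\<in>N. (+) u ` interior K) \<in> sets lebesgue"
        by (intro sets_completionI_sets) simp
      then show "cball 0 R \<inter> DV (double L) \<inter> (\<Union>u\<in>N. (+) u ` interior K) \<in> sets lebesgue"
        unfolding L by (rule sets.Int [OF fmeasurableD [OF DV_cball_lmeasurable]])
    qed (use DV_cball_lmeasurable in \<open>auto simp: L\<close>)
    moreover obtain z where "z \<in> DV (double L)" "norm z = 2 * covering_radius L"
      unfolding L by (rule covering_radius_DV)
    then have "measure lebesgue (cball 0 R \<inter> DV (double L)) < V"
      using measure_cball_DV_strict_mono [OF R, of z] R r(2) vol unfolding L by simp
    ultimately show False
      using N(2) body(4) [OF K] by simp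
  qed
  have "extremal_body L V (K_of L V)"
    unfolding extremal_body_def using adm vol_K diam_K minimal by (meson order_trans)
  moreover have "K = K_of L V" if ext: "extremal_body L V K" for K
  proof -
    have K: "K \<in> admissible_bodies L" "measure lborel K = V"
      and "diameter K \<le> diameter (K_of L V)"
      using ext adm vol_K unfolding extremal_body_def by blast+
    then have diam: "diameter K / 2 \<le> ?r"
      using diam_K by simp
    \<comment> \<open>Extremality bounds the diameter of \<open>K\<close> by that of
      \<open>K_of L V\<close>, so by symmetry \<open>K\<close> lies in the ball of radius
      \<open>?r\<close> and the equality case applies.\<close>
    interpret extremal "double (lattice_of_matrix A)" K ?r
    proof
      show "convex K" "compact K" "K = uminus ` K"
        by (fact body(2) [OF K] body(1) [OF K] body(3) [OF K])+
      have "K \<subseteq> cball 0 (diameter K / 2)"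
        by (rule diameter_symmetric [OF compact_imp_bounded [OF body(1) [OF K]] body(3) [OF K]])
      also have "\<dots> \<subseteq> cball 0 ?r"
        using diam by (rule subset_cball)
      finally show "K \<subseteq> cball 0 ?r" .
      show "0 < ?r"
        by (rule r)
      show "(1/2) *\<^sub>R v \<notin> interior K" if "v \<in> double (lattice_of_matrix A)" "v \<noteq> 0" for v
        using body(5) [OF K] that unfolding L by blast
      show "measure lebesgue K = measure lebesgue (cball 0 ?r \<inter> DV (double (lattice_of_matrix A)))"
        using body(4) [OF K] vol unfolding L by simp
    qed
    have "K = cball 0 ?r \<inter> DV (double (lattice_of_matrix A))"
      by (rule eq_cball_DV) (use assms(8) in \<open>auto simp: L\<close>)
    then show ?thesis
      unfolding K_of_def L .
  qed
  ultimately show ?thesis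
    by blast
qed

end
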